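(* Let $g\ge2$ be an integer, let $\Sigma\subseteq\{0,\dots,g-1\}^{\mathbb{N}_0}$ be a transitive sofic subshift, let $a\in\mathbb{N}$ and let $b$ be a non-negative integer. If there exists $w\in\mathcal{L}(\Sigma)$ such that $|w|\geq a-1$ and $(w)_g\equiv b\pmod a$, then $$\dim_{\mathrm M}(A_\Sigma\cap(a\mathbb{N}+b))=\dim_{\mathrm M}(A_\Sigma).$$ In particular, either this equality holds, or $|A_\Sigma\cap(a\mathbb{N}+b)|\leq g^a$.
   Context: $\mathbb{N}=\{1,2,\dots\}$, $\mathbb{N}_0=\mathbb{N}\cup\{0\}$, $a\mathbb{N}+b=\{an+b:n\in\mathbb{N}\}$. A subshift is a non-empty closed set $\Sigma\subseteq\{0,\dots,g-1\}^{\mathbb{N}_0}$ with $\sigma(\Sigma)\subseteq\Sigma$, $\sigma$ being the left shift. $\mathcal{L}(\Sigma)$ is the set of finite words (including the empty word) that are initial segments of elements of $\Sigma$. $\Sigma$ is transitive if for all $u,v\in\mathcal{L}(\Sigma)$ there is $w\in\mathcal{L}(\Sigma)$ with $uwv\in\mathcal{L}(\Sigma)$; it is sofic if it is the set of label sequences of infinite paths in some finite edge-labelled directed multigraph. For $w=w_0\cdots w_{n-1}$: $|w|=n$ and $(w)_g=w_0+w_1g+\dots+w_{n-1}g^{n-1}$. $A_\Sigma=\{(w)_g:w\in\mathcal{L}(\Sigma)\}$. The mass dimension is $\dim_{\mathrm M}(A)=\lim_{N\to\infty}\frac{\log|A\cap[0,N)|}{\log N}$ (equality of mass dimensions includes the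 assertion that the limit exists; it always exists for $A_\Sigma$). *)

theory Defs
  imports
    "HOL-Analysis.Analysis"
    "HOL-Number_Theory.Cong"
    "Graph_Theory.Digraph"
begin

definition left_shift :: "(nat \<Rightarrow> nat) \<Rightarrow> (nat \<Rightarrow> nat)" where
  "left_shift x = (\<lambda>i. x (Suc i))"

text \<open>Here \<open>closed\<close> refers to the product topology on \<open>nat \<Rightarrow> nat\<close> over the discrete
  topology of \<open>nat\<close>.  The sequences over \<open>{..<g}\<close> form a closed subspace, so this agrees
  with being closed in that subspace.\<close>

definition subshift :: "nat \<Rightarrow> (nat \<Rightarrow> nat) set \<Rightarrow> bool" where
  "subshift g \<Sigma> \<longleftrightarrow>
     \<Sigma> \<noteq> {} \<and> (\<forall>x\<in>\<Sigma>. \<forall>i. x i < g) \<and> closed \<Sigma> \<and> left_shift ` \<Sigma> \<subseteq> \<Sigma>"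

definition language :: "(nat \<Rightarrow> nat) set \<Rightarrow> nat list set" where
  "language \<Sigma> = {map x [0..<n] | x n. x \<in> \<Sigma>}"

definition transitive_shift :: "(nat \<Rightarrow> nat) set \<Rightarrow> bool" where
  "transitive_shift \<Sigma> \<longleftrightarrow>
     (\<forall>u\<in>language \<Sigma>. \<forall>v\<in>language \<Sigma>. \<exists>w\<in>language \<Sigma>. u @ w @ v \<in> language \<Sigma>)"

definition infinite_path :: "('a, 'b) pre_digraph \<Rightarrow> (nat \<Rightarrow> 'b) \<Rightarrow> bool" where
  "infinite_path G e \<longleftrightarrow>
     (\<forall>i. e i \<in> arcs G) \<and> (\<forall>i. head G (e i) = tail G (e (Suc i)))"

text \<open>A \<open>fin_digraph\<close> may have loops and parallel arcs.  As it is finite, nothing is lost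
  by taking its vertices and arcs to be natural numbers.\<close>

definition sofic :: "(nat \<Rightarrow> nat) set \<Rightarrow> bool" where
  "sofic \<Sigma> \<longleftrightarrow>
     (\<exists>(G :: (nat, nat) pre_digraph) (lab :: nat \<Rightarrow> nat).
        fin_digraph G \<and> \<Sigma> = {(\<lambda>i. lab (e i)) | e. infinite_path G e})"

definition word_value :: "nat \<Rightarrow> nat list \<Rightarrow> nat" where
  "word_value g w = (\<Sum>i<length w. w ! i * g ^ i)"

definition shift_integers :: "nat \<Rightarrow> (nat \<Rightarrow> nat) set \<Rightarrow> nat set" where
  "shift_integers g \<Sigma> = word_value g ` language \<Sigma>"

definition arith_prog :: "nat \<Rightarrow> nat \<Rightarrow> nat set" where
  "arith_prog a b = {a * n + b | n. n \<ge> 1}"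

text \<open>Since \<open>ln 0 = 0\<close>, the empty set has mass dimension \<open>0\<close>; for a nonempty \<open>A\<close>
  only the logarithm of eventually positive numbers is involved.  A convention for the empty
  set is needed: if \<open>\<Sigma>\<close> consists of the zero sequence alone, then
  \<open>shift_integers g \<Sigma> = {0}\<close> misses every \<open>arith_prog a b\<close>.\<close>

definition has_mass_dim :: "nat set \<Rightarrow> real \<Rightarrow> bool" where
  "has_mass_dim A d \<longleftrightarrow>
     (\<lambda>N::nat. ln (real (card (A \<inter> {0..<N}))) / ln (real N)) \<longlonglongrightarrow> d"

definition same_mass_dim :: "nat set \<Rightarrow> nat set \<Rightarrow> bool" where
  "same_mass_dim A B \<longleftrightarrow> (\<exists>d. has_mass_dim A d \<and> has_mass_dim B d)"

end

(* The number of elements of A_Sigma below g^n is submultiplicative in n, so the mass dimension of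
   A_Sigma exists by Fekete's lemma.  Since Sigma is sofic, words have finitely many follower sets.
   By transitivity, w can be extended by powers of some word c to a word w' from whose
   follower set every continuation can return to that set.  As |w| >= a - 1, the sequence
   g^|w|, g^(|w|+1), ... is purely periodic modulo a, with period j say, so the (j a)-th power of any
   word placed after w has value 0 modulo a; in particular w' may be chosen with (w')_g = b mod a.
   A word x returning to the follower set of w' is in one of finitely many classes
   (|x| mod j, (x)_g mod a); appending the (j a - 1)-st power of a representative y of its class
   cancels the contribution of x.  Thus every word u occurs in a word p u t of value b modulo a with
   p and t from finite sets, so passing to the residue class costs at most a factor O(n). *)

theory Submission
  imports Defs "HOL-Real_Asymp.Real_Asymp"
begin

section \<open>Follower sets and powers of words\<close>

definition follower :: "'a list set \<Rightarrow> 'a list \<Rightarrow> 'a list set" where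
  "follower L u = {v. u @ v \<in> L}"

abbreviation list_pow :: "'a list \<Rightarrow> nat \<Rightarrow> 'a list" where
  "list_pow u n \<equiv> concat (replicate n u)"

lemma list_pow_mult: "list_pow u (m * n) = list_pow (list_pow u m) n"
  by (induction n) (simp_all add: replicate_add)

lemma list_pow_rotate: "u @ list_pow (v @ u) n = list_pow (u @ v) n @ u"
  by (induction n) simp_all

section \<open>Recurrent words in transitive languages with finitely many followers\<close>

text \<open>One preimage in \<open>P\<close> is chosen for each of the finitely many values of
  \<open>f\<close>. This is what later makes the sets of contexts finite.\<close>

lemma finite_representatives:
  assumes "finite (range f)"
  obtains R where "finite R" "\<And>x. P x \<Longrightarrow> \<exists>y\<in>R. P y \<and> f y = f x"
proof
  show "finite (inv_into (Collect P) f ` f ` Collect P)"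
    using assms by (meson finite_imageI finite_subset image_mono subset_UNIV)
  show "\<exists>y\<in>inv_into (Collect P) f ` f ` Collect P. P y \<and> f y = f x" if "P x" for x
  proof -
    have "f x \<in> f ` Collect P" using that by simp
    then show ?thesis
      by (metis f_inv_into_f imageI inv_into_into mem_Collect_eq)
  qed
qed

text \<open>Over a finite alphabet, \<open>finite_followers\<close> is regularity in the sense of
  Myhill and Nerode: follower sets are the states of a deterministic automaton, an empty one being
  its dead state.\<close>

locale transitive_regular_language =
  fixes L :: "'a list set"
  assumes factor: "u @ v @ w \<in> L \<Longrightarrow> v \<in> L"
    and transitive: "u \<in> L \<Longrightarrow> v \<in> L \<Longrightarrow> \<exists>w. u @ w @ v \<in> L"
    and finite_followers: "finite (range (follower L))"
begin

lemma prefix: "u @ v \<in> L \<Longrightarrow> u \<in> L"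
  using factor[of "[]" u v] by simp

lemma suffix: "u @ v \<in> L \<Longrightarrow> v \<in> L"
  using factor[of u v "[]"] by simp

lemma follower_append_cong:
  "follower L u = follower L u' \<Longrightarrow> follower L (u @ v) = follower L (u' @ v)"
  by (auto simp: follower_def set_eq_iff)

lemma follower_cong_mem:
  "follower L u = follower L u' \<Longrightarrow> u @ v \<in> L \<longleftrightarrow> u' @ v \<in> L"
  by (auto simp: follower_def set_eq_iff)

lemma follower_cong_mem': "follower L u = follower L u' \<Longrightarrow> u \<in> L \<longleftrightarrow> u' \<in> L"
  using follower_cong_mem[of u u' "[]"] by simp

lemma follower_list_pow:
  assumes "follower L (w @ y) = follower L w"
  shows "follower L (w @ list_pow y n) = follower L w"
proof (induction n)
  case (Suc n)
  show ?case
    using follower_append_cong[OF assms, of "list_pow y n"] Suc by simp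
qed simp

text \<open>In the automaton of follower sets, the state of \<open>w\<close> lies in a terminal
  strongly connected component, the dead state being ignored.\<close>

definition recurrent :: "'a list \<Rightarrow> bool" where
  "recurrent w \<longleftrightarrow>
     w \<in> L \<and> (\<forall>v. w @ v \<in> L \<longrightarrow> (\<exists>v'. follower L (w @ v @ v') = follower L w))"

text \<open>Returning to the state of \<open>w\<close> and then reading \<open>v\<close> again
  returns to the state of \<open>w @ v\<close>.\<close>

lemma recurrent_append:
  assumes "recurrent w" "w @ v \<in> L"
  shows "recurrent (w @ v)"
  unfolding recurrent_def
proof (intro conjI allI impI)
  fix x assume "(w @ v) @ x \<in> L"
  then obtain y where "follower L (w @ (v @ x) @ y) = follower L w"
    using assms(1) unfolding recurrent_def by (metis append_assoc)
  from follower_append_cong[OF this, of v]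
  show "\<exists>v'. follower L ((w @ v) @ x @ v') = follower L (w @ v)"
    by (intro exI[of _ "y @ v"]) simp
qed (fact assms(2))

text \<open>Take the extension from which the fewest live states are reachable. Extending it further
  can only shrink this set, so by minimality the set stays the same and still contains the starting
  state.\<close>

lemma ex_recurrent_extension:
  assumes "w \<in> L"
  obtains s where "recurrent (w @ s)"
proof -
  define reach where "reach u = {follower L (u @ s) | s. u @ s \<in> L}" for u
  have fin: "finite (reach u)" for u
    by (rule finite_subset[OF _ finite_followers]) (auto simp: reach_def)
  obtain s where s: "w @ s \<in> L"
    and min: "\<And>s'. w @ s' \<in> L \<Longrightarrow> card (reach (w @ s)) \<le> card (reach (w @ s'))"
    using ex_has_least_nat[of "\<lambda>s. w @ s \<in> L" "[]" "\<lambda>s. card (reach (w @ s))"] assms by auto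
  have "recurrent (w @ s)"
    unfolding recurrent_def
  proof (intro conjI allI impI)
    fix v assume v: "(w @ s) @ v \<in> L"
    have "reach (w @ s @ v) \<subseteq> reach (w @ s)"
    proof
      fix f assume "f \<in> reach (w @ s @ v)"
      then obtain s' where "f = follower L ((w @ s) @ v @ s')" "(w @ s) @ v @ s' \<in> L"
        by (auto simp: reach_def)
      then show "f \<in> reach (w @ s)" unfolding reach_def by blast
    qed
    then have "reach (w @ s @ v) = reach (w @ s)"
      using min[of "s @ v"] v fin by (intro card_seteq) auto
    moreover have "follower L (w @ s) \<in> reach (w @ s)"
      using s by (auto simp: reach_def intro!: exI[of _ "[]"])
    ultimately have "follower L (w @ s) \<in> reach (w @ s @ v)" by simp
    then show "\<exists>v'. follower L ((w @ s) @ v @ v') = follower L (w @ s)"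
      unfolding reach_def by auto
  qed (fact s)
  then show thesis ..
qed

text \<open>All positive powers are provided so that the exponent can later be \<open>j * a\<close>,
  for which the appended block has value 0 modulo \<open>a\<close>.\<close>

lemma ex_recurrent_list_pow:
  assumes "w \<in> L"
  obtains c where "\<And>n. n > 0 \<Longrightarrow> recurrent (w @ list_pow c n)"
proof -
  obtain s where s: "recurrent (w @ s)" using ex_recurrent_extension[OF assms] .
  then have ws: "w @ s \<in> L" by (simp add: recurrent_def)
  \<comment> \<open>Transitivity puts a second \<open>w @ s\<close> after the first; recurrence then
    closes this to a loop at \<open>w @ s\<close> that reads \<open>w\<close> on its way.\<close>
  obtain z where "(w @ s) @ z @ (w @ s) \<in> L" using transitive[OF ws ws] by blast
  then obtain v where "follower L ((w @ s) @ (z @ w @ s) @ v) = follower L (w @ s)"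
    using s unfolding recurrent_def by blast
  then have loop: "follower L ((w @ s) @ z @ w @ s @ v) = follower L (w @ s)" by simp
  \<comment> \<open>Rotating the loop \<open>z w s v\<close> at \<open>w s\<close> gives \<open>c\<close>, which can follow \<open>w\<close> directly and starts
    with \<open>s\<close>, so that \<open>w c\<close> passes through the recurrent word \<open>w s\<close>.\<close>
  define c where "c = s @ v @ z @ w"
  have "recurrent (w @ list_pow c n)" if "n > 0" for n
  proof -
    \<comment> \<open>Running the loop \<open>n + 1\<close> times is needed for \<open>n\<close>
      full copies of \<open>c\<close> to appear after an inner occurrence of
      \<open>w\<close>.\<close>
    have "(w @ s) @ list_pow (z @ w @ s @ v) (Suc n) \<in> L"
      using follower_cong_mem'[OF follower_list_pow[OF loop]] ws by blast
    moreover have "list_pow (z @ w @ s @ v) (Suc n) = z @ (w @ list_pow c n) @ s @ v"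
      using list_pow_rotate[of "s @ v" n "z @ w"] by (simp add: c_def)
    ultimately have "(w @ s @ z) @ (w @ list_pow c n) @ (s @ v) \<in> L" by simp
    then have "w @ list_pow c n \<in> L" by (rule factor)
    moreover have "w @ list_pow c n = (w @ s) @ v @ z @ w @ list_pow c (n - 1)"
      using that by (cases n) (simp_all add: c_def)
    ultimately show ?thesis using recurrent_append[OF s] by metis
  qed
  then show thesis ..
qed

end

section \<open>Values of words modulo \<open>a\<close>\<close>

lemma word_value_Cons: "word_value g (x # w) = x + g * word_value g w"
  by (simp add: word_value_def sum.lessThan_Suc_shift sum_distrib_left mult_ac del: sum.lessThan_Suc)

lemma word_value_append:
  "word_value g (u @ v) = word_value g u + g ^ length u * word_value g v"
  by (induction u) (simp add: word_value_def, simp add: word_value_Cons algebra_simps)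

lemma word_value_Nil [simp]: "word_value g [] = 0"
  by (simp add: word_value_def)

lemma word_value_less:
  assumes "set w \<subseteq> {..<g}"
  shows "word_value g w < g ^ length w"
  using assms
proof (induction w rule: rev_induct)
  case (snoc x w)
  then have "word_value g (w @ [x]) < g ^ length w + g ^ length w * x"
    by (simp add: word_value_append) (simp add: word_value_def)
  also have "\<dots> = g ^ length w * Suc x" by simp
  also have "\<dots> \<le> g ^ length w * g" using snoc.prems by (intro mult_left_mono) auto
  finally show ?case by (simp add: mult.commute)
qed simp

text \<open>The least significant digit comes first, so cutting a word after \<open>m\<close>
  letters is division with remainder by \<open>g ^ m\<close>. If \<open>m\<close> exceeds the
  length, the quotient is the value of the empty word.\<close>

lemma mod_div_word_value:
  assumes g: "g > 0" and w: "set w \<subseteq> {..<g}"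
  shows "word_value g w mod g ^ m = word_value g (take m w)"
    and "word_value g w div g ^ m = word_value g (drop m w)"
proof -
  have "word_value g w = word_value g (take m w) + g ^ length (take m w) * word_value g (drop m w)"
    using word_value_append[of g "take m w" "drop m w"] by simp
  also have "\<dots> = word_value g (take m w) + g ^ m * word_value g (drop m w)"
    by (cases "m \<le> length w") (simp_all add: min_def)
  finally have eq: "word_value g w = word_value g (take m w) + g ^ m * word_value g (drop m w)" .
  have "word_value g (take m w) < g ^ length (take m w)"
    using w by (intro word_value_less) (meson order_trans set_take_subset)
  also have "\<dots> \<le> g ^ m" using g by (intro power_increasing) auto
  finally have "word_value g (take m w) < g ^ m" .
  then show "word_value g w mod g ^ m = word_value g (take m w)"
    and "word_value g w div g ^ m = word_value g (drop m w)"
    using g by (simp_all add: eq)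
qed

text \<open>By pigeonhole two of the \<open>a + 1\<close> powers with exponents 0 to
  \<open>a\<close> agree modulo \<open>a\<close>. The smaller exponent is at most
  \<open>a - 1\<close>, so periodicity holds from there on; this is the source of the bound on the
  length of \<open>w\<close>.\<close>

lemma ex_period_power_mod:
  fixes g a :: nat
  assumes "a \<ge> 1"
  obtains j where "j \<ge> 1" "\<And>k m. k \<ge> a - 1 \<Longrightarrow> [g ^ (k + j * m) = g ^ k] (mod a)"
proof -
  have "\<not> inj_on (\<lambda>i. g ^ i mod a) {..a}"
  proof
    assume "inj_on (\<lambda>i. g ^ i mod a) {..a}"
    moreover have "(\<lambda>i. g ^ i mod a) ` {..a} \<subseteq> {..<a}" using assms by auto
    ultimately have "card {..a} \<le> card {..<a}" by (intro card_inj_on_le) auto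
    then show False by simp
  qed
  then obtain i i' where i: "i < i'" "i' \<le> a" "[g ^ i' = g ^ i] (mod a)"
    unfolding inj_on_def cong_def by (metis atMost_iff linorder_neqE_nat)
  define j where "j = i' - i"
  have step: "[g ^ (k + j) = g ^ k] (mod a)" if "k \<ge> a - 1" for k
  proof -
    have "[g ^ (k - i) * g ^ i' = g ^ (k - i) * g ^ i] (mod a)"
      using i(3) by (rule cong_scalar_left)
    moreover have "k - i + i' = k + j" "k - i + i = k" using that i by (auto simp: j_def)
    ultimately show ?thesis by (simp flip: power_add)
  qed
  have "[g ^ (k + j * m) = g ^ k] (mod a)" if "k \<ge> a - 1" for k m
  proof (induction m)
    case (Suc m)
    have "[g ^ (k + j * m + j) = g ^ (k + j * m)] (mod a)" using that by (intro step) simp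
    then show ?case using Suc by (simp add: add_ac) (metis cong_trans)
  qed simp
  moreover have "j \<ge> 1" using i by (simp add: j_def)
  ultimately show thesis using that by blast
qed

lemma length_list_pow [simp]: "length (list_pow y n) = n * length y"
  by (induction n) simp_all

text \<open>A block of \<open>j\<close> copies of \<open>y\<close> has length divisible by
  \<open>j\<close>, so every block contributes the same residue, and \<open>a\<close> equal residues
  add up to 0.\<close>

lemma word_value_list_pow_cong_0:
  assumes period: "\<And>m. [g ^ (k + j * m) = g ^ k] (mod a)"
  shows "[g ^ k * word_value g (list_pow y (j * a)) = 0] (mod a)"
proof -
  define Y where "Y = list_pow y j"
  have "[g ^ k * word_value g (list_pow Y n) = n * (g ^ k * word_value g Y)] (mod a)" for n
  proof (induction n)
    case (Suc n)
    have "g ^ k * word_value g (list_pow Y (Suc n)) =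
        g ^ k * word_value g Y + g ^ (k + j * length y) * word_value g (list_pow Y n)"
      by (simp add: word_value_append Y_def power_add algebra_simps)
    also have "[\<dots> = g ^ k * word_value g Y + g ^ k * word_value g (list_pow Y n)] (mod a)"
      by (intro cong_add cong_refl cong_scalar_right period)
    also have "[g ^ k * word_value g Y + g ^ k * word_value g (list_pow Y n) =
        g ^ k * word_value g Y + n * (g ^ k * word_value g Y)] (mod a)"
      by (intro cong_add cong_refl Suc)
    finally show ?case by (simp add: algebra_simps)
  qed simp
  from this[of a] have "[g ^ k * word_value g (list_pow Y a) = 0] (mod a)"
    by (simp add: cong_def)
  then show ?thesis by (simp add: list_pow_mult Y_def)
qed

text \<open>Only states and residues matter, so finitely many contexts suffice: \<open>Z\<close>
  leads from \<open>w'\<close> to \<open>u\<close>, \<open>R\<close> supplies returns to the state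
  of \<open>w'\<close>, and powers of words in \<open>Y\<close> correct the residue.\<close>

lemma ex_bounded_contexts:
  fixes g a b :: nat and L :: "nat list set"
  assumes L: "transitive_regular_language L"
    and a: "a \<ge> 1" and w: "w \<in> L" "length w \<ge> a - 1" "[word_value g w = b] (mod a)"
  obtains P T where "finite P" "finite T"
    "\<And>u. u \<in> L \<Longrightarrow> \<exists>p\<in>P. \<exists>t\<in>T. p @ u @ t \<in> L \<and> [word_value g (p @ u @ t) = b] (mod a)"
proof -
  interpret transitive_regular_language L by (fact L)
  obtain j where j: "j \<ge> 1" and period: "\<And>k m. k \<ge> a - 1 \<Longrightarrow> [g ^ (k + j * m) = g ^ k] (mod a)"
    using ex_period_power_mod[OF a] by blast
  note pow0 = word_value_list_pow_cong_0[OF period]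
  obtain c where c: "\<And>n. n > 0 \<Longrightarrow> recurrent (w @ list_pow c n)"
    using ex_recurrent_list_pow[OF w(1)] by metis
  define w' where "w' = w @ list_pow c (j * a)"
  have rec: "recurrent w'" using a j by (auto simp: w'_def intro!: c)
  then have w'L: "w' \<in> L" by (simp add: recurrent_def)
  have w'len: "length w' \<ge> a - 1" using w(2) by (simp add: w'_def)
  have "[word_value g w' = b + 0] (mod a)"
    unfolding w'_def word_value_append using w by (intro cong_add pow0) auto
  then have w'val: "[word_value g w' = b] (mod a)" by simp

  have "finite (range (\<lambda>z. follower L (w' @ z)))"
    by (rule finite_subset[OF _ finite_followers]) auto
  from finite_representatives[OF this, of "\<lambda>_. True"]
  obtain Z where Z: "finite Z" "\<And>z. \<exists>z'\<in>Z. follower L (w' @ z') = follower L (w' @ z)"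
    by auto
  have "finite (range (\<lambda>p. follower L (fst p)))"
    by (rule finite_subset[OF _ finite_followers]) auto
  \<comment> \<open>A pair is a word together with a continuation to the state of \<open>w'\<close>.
    The continuation works from every word in the same state, so one pair per state is
    enough.\<close>
  from finite_representatives[OF this, of "\<lambda>p. follower L (fst p @ snd p) = follower L w'"]
  obtain R where R: "finite R"
    "\<And>p. follower L (fst p @ snd p) = follower L w' \<Longrightarrow>
       \<exists>q\<in>R. follower L (fst q @ snd q) = follower L w' \<and> follower L (fst q) = follower L (fst p)"
    by blast
  \<comment> \<open>These two residues determine, modulo \<open>a\<close>, what a word adds after
    \<open>w'\<close> and the factor by which it shifts what follows.\<close>
  have "finite (range (\<lambda>x. (length x mod j, word_value g x mod a)))"
    by (rule finite_subset[of _ "{..<j} \<times> {..<a}"]) (use a j in auto)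
  from finite_representatives[OF this, of "\<lambda>x. follower L (w' @ x) = follower L w'"]
  obtain Y where Y: "finite Y"
    "\<And>x. follower L (w' @ x) = follower L w' \<Longrightarrow>
       \<exists>y\<in>Y. follower L (w' @ y) = follower L w' \<and>
         (length y mod j, word_value g y mod a) = (length x mod j, word_value g x mod a)"
    by blast
  define P where "P = (@) w' ` Z"
  define T where "T = (\<lambda>(v, y). v @ list_pow y (j * a - 1)) ` (snd ` R \<times> Y)"
  have "\<exists>p\<in>P. \<exists>t\<in>T. p @ u @ t \<in> L \<and> [word_value g (p @ u @ t) = b] (mod a)" if u: "u \<in> L" for u
  proof -
    \<comment> \<open>The connecting word \<open>z0\<close> depends on \<open>u\<close>; it is
      replaced by a representative leading to the same state.\<close>
    obtain z0 where "w' @ z0 @ u \<in> L" using transitive[OF w'L u] by blast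
    moreover obtain z where z: "z \<in> Z" "follower L (w' @ z) = follower L (w' @ z0)"
      using Z(2) by blast
    ultimately have "(w' @ z) @ u \<in> L" using follower_cong_mem[OF z(2), of u] by simp
    then obtain v0 where "follower L (w' @ (z @ u) @ v0) = follower L w'"
      using rec unfolding recurrent_def by (metis append_assoc)
    then obtain q where q: "q \<in> R" "follower L (fst q @ snd q) = follower L w'"
      "follower L (fst q) = follower L (w' @ z @ u)"
      using R(2)[of "(w' @ z @ u, v0)"] by auto
    define x where "x = z @ u @ snd q"
    have x: "follower L (w' @ x) = follower L w'"
      using follower_append_cong[OF q(3), of "snd q"] q(2) by (simp add: x_def)
    then obtain y where y: "y \<in> Y" "follower L (w' @ y) = follower L w'"
      and len: "[length x = length y] (mod j)"
      and val: "[word_value g x = word_value g y] (mod a)"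
      using Y(2)[OF x] by (auto simp: cong_def)
    \<comment> \<open>Modulo \<open>a\<close>, the word \<open>x y\<^sup>j\<^sup>a\<^sup>-\<^sup>1\<close> behaves like \<open>y\<^sup>j\<^sup>a\<close> after \<open>w'\<close>, hence contributes \<open>0\<close>.\<close>
    let ?y = "list_pow y (j * a - 1)"
    have "follower L (w' @ x @ ?y) = follower L w'"
      using follower_append_cong[OF x, of ?y] follower_list_pow[OF y(2)] by simp
    then have mem: "w' @ x @ ?y \<in> L" using w'L follower_cong_mem' by blast
    \<comment> \<open>The exponents are at least \<open>a - 1\<close> and congruent modulo
      \<open>j\<close>, so periodicity applies.\<close>
    have pw: "[g ^ (length w' + length x) = g ^ (length w' + length y)] (mod a)"
    proof -
      have *: "[g ^ (length w' + n) = g ^ (length w' + n mod j)] (mod a)" for n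
        using period[of "length w' + n mod j" "n div j"] w'len by (simp add: add.assoc)
      from *[of "length x"] *[of "length y"] len show ?thesis by (simp add: cong_def)
    qed
    have "word_value g (w' @ x @ ?y) = word_value g w' +
        (g ^ length w' * word_value g x + g ^ (length w' + length x) * word_value g ?y)"
      by (simp add: word_value_append power_add algebra_simps)
    also have "[\<dots> = b + (g ^ length w' * word_value g y
        + g ^ (length w' + length y) * word_value g ?y)] (mod a)"
      by (intro cong_add w'val cong_scalar_left val cong_scalar_right pw)
    also have "g ^ length w' * word_value g y + g ^ (length w' + length y) * word_value g ?y =
        g ^ length w' * word_value g (list_pow y (Suc (j * a - 1)))"
      by (simp add: word_value_append power_add algebra_simps)
    also have "Suc (j * a - 1) = j * a" using a j by simp
    also have "[b + g ^ length w' * word_value g (list_pow y (j * a)) = b + 0] (mod a)"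
      by (intro cong_add cong_refl pow0 w'len)
    finally have "[word_value g (w' @ x @ ?y) = b] (mod a)" by simp
    moreover have "w' @ z \<in> P" using z(1) by (simp add: P_def)
    moreover have "snd q @ ?y \<in> T" using q(1) y(1) by (auto simp: T_def)
    ultimately show ?thesis using mem
      by (intro bexI[of _ "w' @ z"] bexI[of _ "snd q @ ?y"]) (auto simp: x_def)
  qed
  moreover have "finite P" "finite T" using Z(1) R(1) Y(1) by (auto simp: P_def T_def)
  ultimately show thesis using that by blast
qed

text \<open>Each value is mapped to the value of its word in context, together with the context and
  the word length. This is injective, the \<open>n + 1\<close> possible lengths cost a linear
  factor, and \<open>K\<close> bounds the number of added digits.\<close>

lemma card_values_le:
  fixes g a b :: nat and L :: "nat list set"
  assumes g: "g \<ge> 2" and digits: "\<And>w. w \<in> L \<Longrightarrow> set w \<subseteq> {..<g}"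
    and L: "transitive_regular_language L"
    and a: "a \<ge> 1" and w: "w \<in> L" "length w \<ge> a - 1" "[word_value g w = b] (mod a)"
  obtains C K where "C > 0" "\<And>n. card (word_value g ` L \<inter> {0..<g ^ n})
     \<le> C * (n + 1) * max 1 (card ((word_value g ` L \<inter> arith_prog a b) \<inter> {0..<g ^ (n + K)}))"
proof -
  interpret transitive_regular_language L by (fact L)
  obtain P T where fin: "finite P" "finite T" and
    PT: "\<And>u. u \<in> L \<Longrightarrow> \<exists>p\<in>P. \<exists>t\<in>T. p @ u @ t \<in> L \<and> [word_value g (p @ u @ t) = b] (mod a)"
    using ex_bounded_contexts[OF L a w] by metis
  define K where "K = Max (insert 0 (length ` P)) + Max (insert 0 (length ` T))"
  \<comment> \<open>The factor \<open>b + 2\<close> absorbs the \<open>b + 1\<close> numbers up to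
    \<open>b\<close>, which \<open>arith_prog\<close> leaves out even when they are congruent to
    \<open>b\<close>.\<close>
  define C where "C = (card P * card T) * (b + 2)"
  define A where "A = word_value g ` L"
  define B where "B = A \<inter> arith_prog a b"
  have K: "length p + length t \<le> K" if "p \<in> P" "t \<in> T" for p t
    unfolding K_def using fin that by (intro add_mono Max_ge) auto
  have "C > 0"
    using PT[OF w(1)] fin by (auto simp: C_def card_gt_0_iff)
  moreover have "card (A \<inter> {0..<g ^ n}) \<le> C * (n + 1) * max 1 (card (B \<inter> {0..<g ^ (n + K)}))" for n
  proof -
    have "\<exists>p t u. p \<in> P \<and> t \<in> T \<and> length u \<le> n \<and> word_value g u = m \<and>
        p @ u @ t \<in> L \<and> [word_value g (p @ u @ t) = b] (mod a)" if m: "m \<in> A \<inter> {0..<g ^ n}" for m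
    proof -
      obtain u where u: "u \<in> L" "word_value g u = m"
        using m unfolding A_def by blast
      have "m < g ^ n" using m by simp
      \<comment> \<open>The word \<open>u\<close> may be long because of trailing zeros; truncation
        to \<open>n\<close> letters keeps its value, as \<open>m < g ^ n\<close>.\<close>
      have tk: "take n u \<in> L" using u(1) prefix[of "take n u" "drop n u"] by simp
      have "word_value g (take n u) = m"
        using mod_div_word_value(1)[of g u n] digits[OF u(1)] u(2) g \<open>m < g ^ n\<close> by simp
      then show ?thesis using PT[OF tk] by (metis length_take min.cobounded2)
    qed
    then obtain p t u where f: "\<And>m. m \<in> A \<inter> {0..<g ^ n} \<Longrightarrow> p m \<in> P \<and> t m \<in> T \<and>
        length (u m) \<le> n \<and> word_value g (u m) = m \<and>
        p m @ u m @ t m \<in> L \<and> [word_value g (p m @ u m @ t m) = b] (mod a)"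
      by metis
    \<comment> \<open>The length of \<open>u m\<close> is recorded because it fixes the position of
      \<open>t m\<close>, whose contribution can then be subtracted.\<close>
    define F where "F m = (word_value g (p m @ u m @ t m), (p m, t m), length (u m))" for m
    let ?B = "B \<inter> {0..<g ^ (n + K)}"
    have "inj_on F (A \<inter> {0..<g ^ n})"
    proof (rule inj_onI)
      fix m m' assume m: "m \<in> A \<inter> {0..<g ^ n}" "m' \<in> A \<inter> {0..<g ^ n}" "F m = F m'"
      then have "p m = p m'" "t m = t m'" "length (u m) = length (u m')"
        and "word_value g (p m @ u m @ t m) = word_value g (p m' @ u m' @ t m')"
        by (auto simp: F_def)
      then have "g ^ length (p m) * word_value g (u m) = g ^ length (p m) * word_value g (u m')"
        by (simp add: word_value_append algebra_simps)
      then show "m = m'" using f[OF m(1)] f[OF m(2)] g by simp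
    qed
    moreover have "F m \<in> (?B \<union> {..b}) \<times> (P \<times> T) \<times> {..n}" if m: "m \<in> A \<inter> {0..<g ^ n}" for m
    proof -
      define x where "x = word_value g (p m @ u m @ t m)"
      note f = f[OF m, folded x_def]
      have "x < g ^ length (p m @ u m @ t m)"
        unfolding x_def using f by (intro word_value_less digits) auto
      also have "\<dots> \<le> g ^ (n + K)" using g K[of "p m" "t m"] f by (intro power_increasing) auto
      finally have "x < g ^ (n + K)" .
      moreover have "x \<in> A" using f by (auto simp: A_def x_def)
      moreover have "x \<in> arith_prog a b" if "x > b"
      proof -
        have "a dvd x - b" using f that by (meson cong_altdef_nat less_imp_le_nat)
        then obtain k where "x - b = a * k" ..
        with that have "x = a * k + b" "k \<ge> 1" by (cases k; simp)+
        then show ?thesis by (auto simp: arith_prog_def)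
      qed
      ultimately have "x \<in> ?B \<union> {..b}" by (auto simp: B_def not_le)
      then show ?thesis using f by (simp add: F_def x_def)
    qed
    moreover have "finite ((?B \<union> {..b}) \<times> (P \<times> T) \<times> {..n})" using fin by simp
    ultimately have "card (A \<inter> {0..<g ^ n}) \<le> card ((?B \<union> {..b}) \<times> (P \<times> T) \<times> {..n})"
      by (blast intro: card_inj_on_le)
    also have "\<dots> = card (?B \<union> {..b}) * (card P * card T * (n + 1))"
      by (simp add: card_cartesian_product)
    also have "\<dots> \<le> ((b + 2) * max 1 (card ?B)) * (card P * card T * (n + 1))"
    proof (rule mult_right_mono)
      have "card (?B \<union> {..b}) \<le> card ?B + (b + 1)" using card_Un_le[of ?B "{..b}"] by simp
      also have "\<dots> \<le> max 1 (card ?B) + (b + 1) * max 1 (card ?B)"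
        using mult_le_mono2[of 1 "max 1 (card ?B)" "b + 1"]
        by (intro add_mono) (simp_all only: mult_1_right max.cobounded1 max.cobounded2)
      also have "\<dots> = (b + 2) * max 1 (card ?B)" by (simp add: algebra_simps)
      finally show "card (?B \<union> {..b}) \<le> (b + 2) * max 1 (card ?B)" .
    qed simp
    finally show ?thesis by (simp only: C_def mult_ac)
  qed
  ultimately show thesis using that unfolding B_def A_def by blast
qed

section \<open>Mass dimension from counts below powers\<close>

text \<open>The limit is the infimum of \<open>s n / n\<close>: fix \<open>m\<close> with quotient
  near the infimum, divide \<open>n\<close> by \<open>m\<close>, and note that the remainder
  contributes a bounded amount.\<close>

lemma fekete:
  fixes s :: "nat \<Rightarrow> real"
  assumes nonneg: "\<And>n. s n \<ge> 0" and subadd: "\<And>m n. s (m + n) \<le> s m + s n"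
  obtains l where "(\<lambda>n. s n / n) \<longlonglongrightarrow> l"
proof -
  define l where "l = (INF n\<in>{1..}. s n / n)"
  have bdd: "bdd_below ((\<lambda>n. s n / real n) ` {1..})"
    by (rule bdd_belowI2[of _ 0]) (simp add: nonneg)
  have "(\<lambda>n. s n / n) \<longlonglongrightarrow> l"
  proof (rule order_tendstoI)
    fix x assume "x < l"
    have "l \<le> s n / n" if "n \<ge> 1" for n
      unfolding l_def using that by (intro cINF_lower bdd) auto
    with \<open>x < l\<close> show "\<forall>\<^sub>F n in sequentially. x < s n / n"
      by (intro eventually_sequentiallyI[of 1]) (meson less_le_trans)
  next
    fix x assume "l < x"
    then obtain m where m: "m \<ge> 1" "s m / m < x"
      using cINF_less_iff[OF _ bdd, of x] by (auto simp: l_def)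
    \<comment> \<open>As all terms are nonnegative, this sum bounds \<open>s r\<close> for every
      remainder \<open>r < m\<close>.\<close>
    define c where "c = (\<Sum>r<m. s r)"
    have mult: "s (q * m + r) \<le> q * s m + s r" for q r
    proof (induction q)
      case (Suc q)
      have "s (Suc q * m + r) \<le> s m + s (q * m + r)" using subadd[of m "q * m + r"] by (simp add: add_ac)
      with Suc show ?case by (simp add: algebra_simps)
    qed simp
    have bound: "s n / n \<le> s m / m + c / n" if "n \<ge> 1" for n
    proof -
      have "s n \<le> real (n div m) * s m + s (n mod m)"
        using mult[of "n div m" "n mod m"] by simp
      also have "s (n mod m) \<le> c"
        unfolding c_def using m nonneg by (intro member_le_sum) auto
      also have "real (n div m) * s m \<le> real n / m * s m"
        using nonneg by (intro mult_right_mono of_nat_div_le_of_nat)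
      finally show ?thesis using that m by (simp add: field_simps)
    qed
    have "(\<lambda>n. s m / m + c / real n) \<longlonglongrightarrow> s m / m + 0"
      by (intro tendsto_intros lim_const_over_n)
    then have "\<forall>\<^sub>F n in sequentially. s m / m + c / real n < x"
      using m(2) by (intro order_tendstoD) auto
    then show "\<forall>\<^sub>F n in sequentially. s n / n < x"
      using eventually_ge_at_top[of 1] by eventually_elim (use bound in force)
  qed
  then show thesis ..
qed

lemma ln_of_nat_mono: "m \<le> n \<Longrightarrow> ln (real m) \<le> ln (real n)"
  by (cases "m = 0"; cases "n = 0") auto

lemma ln_of_nat_nonneg: "0 \<le> ln (real n)"
  by (cases "n = 0") auto

text \<open>Between consecutive powers of \<open>g\<close> the count is monotone and the logarithm
  changes by at most \<open>ln g\<close>, so the quotient at \<open>N\<close> is squeezed between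
  those at the neighbouring powers up to factors tending to 1.\<close>

lemma has_mass_dim_of_powers:
  assumes g: "g \<ge> 2"
    and lim: "(\<lambda>n. ln (real (card (A \<inter> {0..<g ^ n}))) / n) \<longlonglongrightarrow> l"
  shows "has_mass_dim A (l / ln g)"
proof -
  define f where "f n = ln (real (card (A \<inter> {0..<g ^ n})))" for n
  have lng: "ln (real g) > 0" using g by simp
  have mono: "card (A \<inter> {0..<M}) \<le> card (A \<inter> {0..<N})" if "M \<le> N" for M N
    using that by (intro card_mono) auto
  \<comment> \<open>\<open>k N\<close> is the integer part of the logarithm of \<open>N\<close> to
    base \<open>g\<close>.\<close>
  obtain k where k: "\<And>N. N \<ge> 1 \<Longrightarrow> g ^ k N \<le> N \<and> N < g ^ (k N + 1)"
    using ex_power_ivl1[OF g] by metis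
  have "filterlim k at_top sequentially"
    unfolding filterlim_at_top
  proof
    fix M
    have "M \<le> k N" if "N \<ge> g ^ M" for N
    proof -
      have "N \<ge> 1" using that g by (metis le_trans one_le_power numeral_One one_le_numeral)
      then have "g ^ M < g ^ (k N + 1)" using k[of N] that by simp
      then show ?thesis using g by (simp add: power_less_imp_less_exp less_Suc_eq_le power_strict_increasing_iff del: power_Suc)
    qed
    then show "\<forall>\<^sub>F N in sequentially. M \<le> k N" by (rule eventually_sequentiallyI)
  qed
  then have lim_k: "(\<lambda>N. h (k N)) \<longlonglongrightarrow> x" if "h \<longlonglongrightarrow> x" for h and x :: real
    using filterlim_compose[OF that] by blast
  have fl: "(\<lambda>n. f n / real n) \<longlonglongrightarrow> l" using lim by (simp add: f_def)
  have "(\<lambda>n. f n / real n * (real n / real (n + 1))) \<longlonglongrightarrow> l * 1"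
    by (intro tendsto_mult fl) real_asymp
  then have lo: "(\<lambda>n. f n / real n * (real n / real (n + 1)) / ln g) \<longlonglongrightarrow> l / ln g"
    using lng by (intro tendsto_divide) auto
  have "(\<lambda>n. f (Suc n) / real (Suc n) * (real (Suc n) / real n)) \<longlonglongrightarrow> l * 1"
    by (intro tendsto_mult LIMSEQ_Suc[OF fl]) real_asymp
  then have hi: "(\<lambda>n. f (Suc n) / real (Suc n) * (real (Suc n) / real n) / ln g) \<longlonglongrightarrow> l / ln g"
    using lng by (intro tendsto_divide) auto
  have bounds: "f (k N) / real (k N) * (real (k N) / real (k N + 1)) / ln g
        \<le> ln (real (card (A \<inter> {0..<N}))) / ln (real N) \<and>
      ln (real (card (A \<inter> {0..<N}))) / ln (real N)
        \<le> f (Suc (k N)) / real (Suc (k N)) * (real (Suc (k N)) / real (k N)) / ln g"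
    if N: "N \<ge> g" for N
  proof -
    have N1: "N \<ge> 1" using N g by simp
    \<comment> \<open>From \<open>N \<ge> g\<close> the exponent is positive, which keeps the
      denominators away from 0.\<close>
    have "k N \<noteq> 0" using k[OF N1] N by (intro notI) simp
    then have k1: "k N > 0" by simp
    have "ln (real (g ^ k N)) \<le> ln (real N)" "ln (real N) \<le> ln (real (g ^ (k N + 1)))"
      using k[OF N1] by (intro ln_of_nat_mono; simp)+
    then have lnN: "real (k N) * ln g \<le> ln N" "ln N \<le> real (k N + 1) * ln g"
      using g by (simp_all add: ln_realpow ln_mult algebra_simps)
    have "f (k N) / (real (k N + 1) * ln g) \<le> ln (real (card (A \<inter> {0..<N}))) / ln (real N)"
      unfolding f_def using lnN lng k1 k[OF N1] N g
      by (intro frac_le ln_of_nat_mono mono ln_of_nat_nonneg) auto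
    moreover have "ln (real (card (A \<inter> {0..<N}))) / ln (real N) \<le> f (k N + 1) / (real (k N) * ln g)"
      unfolding f_def using lnN lng k1 k[OF N1]
      by (intro frac_le ln_of_nat_mono mono ln_of_nat_nonneg) auto
    ultimately show ?thesis using k1 by (simp del: of_nat_Suc)
  qed
  have ev: "\<forall>\<^sub>F N in sequentially. N \<ge> g" by (rule eventually_ge_at_top)
  show ?thesis
    unfolding has_mass_dim_def
  proof (rule tendsto_sandwich[OF _ _ lim_k[OF lo] lim_k[OF hi]])
  qed (rule eventually_mono[OF ev], use bounds in blast)+
qed

text \<open>\<open>ln 0 = 0\<close> also covers \<open>c = 0\<close>.\<close>

lemma max_1_eq_exp_ln: "real (max 1 c) = exp (ln (real c))"
  by (cases "c = 0") auto

text \<open>Fekete's lemma gives the limit for \<open>A\<close>. The counts of \<open>B\<close> at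
  \<open>n + K\<close> lie between those of \<open>A\<close> at \<open>n\<close> and at
  \<open>n + K\<close>, up to a logarithmic error that vanishes after division by
  \<open>n + K\<close>.\<close>

lemma same_mass_dim_of_card_le:
  assumes g: "g \<ge> 2" and "B \<subseteq> A" and "C > 0" and "0 \<in> A"
    and submult: "\<And>m n. card (A \<inter> {0..<g ^ (m + n)}) \<le> card (A \<inter> {0..<g ^ m}) * card (A \<inter> {0..<g ^ n})"
    and le: "\<And>n. card (A \<inter> {0..<g ^ n}) \<le> C * (n + 1) * max 1 (card (B \<inter> {0..<g ^ (n + K)}))"
  shows "same_mass_dim B A"
proof -
  define \<alpha> where "\<alpha> n = ln (real (card (A \<inter> {0..<g ^ n})))" for n
  define \<beta> where "\<beta> n = ln (real (card (B \<inter> {0..<g ^ n})))" for n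
  \<comment> \<open>Positive counts allow the logarithm of a product to be split despite
    \<open>ln 0 = 0\<close>.\<close>
  have pos: "card (A \<inter> {0..<g ^ n}) > 0" for n
    using \<open>0 \<in> A\<close> g by (auto simp: card_gt_0_iff)
  have "\<alpha> (m + n) \<le> \<alpha> m + \<alpha> n" for m n
  proof -
    have "\<alpha> (m + n) \<le> ln (real (card (A \<inter> {0..<g ^ m}) * card (A \<inter> {0..<g ^ n})))"
      unfolding \<alpha>_def by (intro ln_of_nat_mono submult)
    also have "\<dots> = \<alpha> m + \<alpha> n"
      unfolding \<alpha>_def of_nat_mult by (rule ln_mult_pos) (use pos in auto)
    finally show ?thesis .
  qed
  then obtain l where l: "(\<lambda>n. \<alpha> n / n) \<longlonglongrightarrow> l"
    using fekete[of \<alpha>] ln_of_nat_nonneg unfolding \<alpha>_def by metis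
  have up: "\<beta> n \<le> \<alpha> n" for n
    unfolding \<alpha>_def \<beta>_def using \<open>B \<subseteq> A\<close> by (intro ln_of_nat_mono card_mono) auto
  have lo: "\<alpha> n \<le> ln C + ln (n + 1) + \<beta> (n + K)" for n
  proof -
    have "\<alpha> n \<le> ln (real (C * (n + 1) * max 1 (card (B \<inter> {0..<g ^ (n + K)}))))"
      unfolding \<alpha>_def by (intro ln_of_nat_mono le)
    also have "\<dots> = ln (real C) + ln (real (n + 1)) + ln (real (max 1 (card (B \<inter> {0..<g ^ (n + K)}))))"
      using \<open>C > 0\<close> unfolding of_nat_mult by (subst ln_mult_pos; simp add: ln_mult_pos del: of_nat_Suc of_nat_add)
    also have "ln (real (max 1 (card (B \<inter> {0..<g ^ (n + K)})))) = \<beta> (n + K)"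
      unfolding max_1_eq_exp_ln \<beta>_def by simp
    finally show ?thesis by (simp add: add.commute)
  qed
  have "(\<lambda>n. \<alpha> n / n * (real n / real (n + K)) - (ln C + ln (real n + 1)) / real (n + K)) \<longlonglongrightarrow> l * 1 - 0"
    by (intro tendsto_diff tendsto_mult l) real_asymp+
  then have lo': "(\<lambda>n. \<alpha> n / n * (real n / real (n + K)) - (ln C + ln (real n + 1)) / real (n + K)) \<longlonglongrightarrow> l"
    by simp
  have "(\<lambda>n. \<beta> (n + K) / real (n + K)) \<longlonglongrightarrow> l"
  proof (rule tendsto_sandwich[OF _ _ lo' LIMSEQ_ignore_initial_segment[OF l, of K]])
    show "\<forall>\<^sub>F n in sequentially. \<alpha> n / n * (real n / real (n + K)) - (ln C + ln (real n + 1)) / real (n + K)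
        \<le> \<beta> (n + K) / real (n + K)"
      using eventually_gt_at_top[of 0]
    proof eventually_elim
      case (elim n)
      have "(\<alpha> n - (ln C + ln (real n + 1))) / real (n + K) \<le> \<beta> (n + K) / real (n + K)"
        using lo[of n] by (intro divide_right_mono) (auto simp: add_ac)
      then show ?case using elim by (simp add: diff_divide_distrib)
    qed
    show "\<forall>\<^sub>F n in sequentially. \<beta> (n + K) / real (n + K) \<le> \<alpha> (n + K) / real (n + K)"
      by (intro always_eventually allI divide_right_mono up) auto
  qed
  then have "(\<lambda>n. \<beta> n / n) \<longlonglongrightarrow> l" by (rule LIMSEQ_offset)
  then have "has_mass_dim B (l / ln g)" "has_mass_dim A (l / ln g)"
    using l unfolding \<alpha>_def \<beta>_def by (auto intro: has_mass_dim_of_powers[OF g])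
  then show ?thesis unfolding same_mass_dim_def by blast
qed

section \<open>Languages of sofic shifts\<close>

text \<open>This is the subset construction: the follower set of \<open>u\<close> depends only on
  the set \<open>ends u\<close> of vertices at which paths reading \<open>u\<close> can arrive, and
  a finite graph has finitely many such sets.\<close>

lemma sofic_finite_followers:
  assumes "sofic \<Sigma>"
  shows "finite (range (follower (language \<Sigma>)))"
proof -
  obtain G :: "(nat, nat) pre_digraph" and lab where G: "fin_digraph G"
    and \<Sigma>: "\<Sigma> = {(\<lambda>i. lab (e i)) | e. infinite_path G e}"
    using assms unfolding sofic_def by blast
  interpret fin_digraph G by (fact G)
  define reads where "reads e u \<longleftrightarrow> infinite_path G e \<and> (\<forall>i<length u. lab (e i) = u ! i)" for e u
  define ends where "ends u = {tail G (e (length u)) | e. reads e u}" for u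
  have lang: "u \<in> language \<Sigma> \<longleftrightarrow> (\<exists>e. reads e u)" for u
  proof -
    have map_eq: "u = map (\<lambda>i. lab (e i)) [0..<length u] \<longleftrightarrow> (\<forall>i<length u. lab (e i) = u ! i)" for e
    proof
      assume "u = map (\<lambda>i. lab (e i)) [0..<length u]"
      then have "u ! i = map (\<lambda>i. lab (e i)) [0..<length u] ! i" for i
        by (rule arg_cong)
      then show "\<forall>i<length u. lab (e i) = u ! i" by simp
    qed (rule nth_equalityI; simp)
    have "u \<in> language \<Sigma> \<longleftrightarrow> (\<exists>e n. infinite_path G e \<and> u = map (\<lambda>i. lab (e i)) [0..<n])"
      unfolding language_def \<Sigma> by blast
    also have "\<dots> \<longleftrightarrow> (\<exists>e. infinite_path G e \<and> u = map (\<lambda>i. lab (e i)) [0..<length u])"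
      by (metis length_map length_upt diff_zero)
    also have "\<dots> \<longleftrightarrow> (\<exists>e. reads e u)"
      unfolding reads_def map_eq ..
    finally show ?thesis .
  qed
  have sub: "follower (language \<Sigma>) u \<subseteq> follower (language \<Sigma>) u'" if ends: "ends u = ends u'" for u u'
  proof
    fix v assume "v \<in> follower (language \<Sigma>) u"
    then obtain e where e: "reads e (u @ v)" by (auto simp: follower_def lang)
    then have "reads e u" by (auto simp: reads_def nth_append)
    then have "tail G (e (length u)) \<in> ends u'" unfolding ends[symmetric] by (auto simp: ends_def)
    then obtain e' where e': "reads e' u'" "tail G (e' (length u')) = tail G (e (length u))"
      by (auto simp: ends_def)
    \<comment> \<open>The path reading \<open>u'\<close> is spliced with the tail of the path
      reading \<open>u @ v\<close>; both pass through the same vertex at the junction.\<close>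
    define d where "d i = (if i < length u' then e' i else e (i - length u' + length u))" for i
    have "head G (d i) = tail G (d (Suc i))" for i
    proof -
      consider "Suc i < length u'" | "Suc i = length u'" | "length u' \<le> i" by linarith
      then show ?thesis
      proof cases
        case 2
        then have "head G (d i) = tail G (e' (length u'))"
          using e'(1) by (auto simp: d_def reads_def infinite_path_def)
        then show ?thesis using 2 e'(2) by (simp add: d_def)
      next
        case 3
        then show ?thesis using e by (auto simp: d_def reads_def infinite_path_def Suc_diff_le)
      qed (use e' in \<open>auto simp: d_def reads_def infinite_path_def\<close>)
    qed
    moreover have "d i \<in> arcs G" for i
      using e e'(1) by (auto simp: d_def reads_def infinite_path_def)
    moreover have "lab (d i) = (u' @ v) ! i" if "i < length (u' @ v)" for i
    proof (cases "i < length u'")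
      case False
      then obtain k where k: "i = length u' + k" by (metis le_add_diff_inverse not_less)
      with that have "lab (e (length u + k)) = (u @ v) ! (length u + k)"
        using e by (simp add: reads_def)
      then show ?thesis by (simp add: k d_def nth_append add.commute)
    qed (use e'(1) in \<open>auto simp: d_def reads_def nth_append\<close>)
    ultimately have "reads d (u' @ v)" by (simp add: reads_def infinite_path_def)
    then show "v \<in> follower (language \<Sigma>) u'" by (auto simp: follower_def lang)
  qed
  have "range ends \<subseteq> Pow (verts G)"
    by (auto simp: ends_def reads_def infinite_path_def)
  then have "finite (range ends)"
    by (rule finite_subset) simp
  then obtain R where R: "finite R" "\<And>u. \<exists>r\<in>R. ends r = ends u"
    using finite_representatives[of ends "\<lambda>_. True"] by auto
  have "range (follower (language \<Sigma>)) \<subseteq> follower (language \<Sigma>) ` R"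
  proof (rule image_subsetI)
    fix u
    obtain r where r: "r \<in> R" "ends r = ends u" using R(2) by blast
    then have "follower (language \<Sigma>) u = follower (language \<Sigma>) r"
      by (intro equalityI sub) simp_all
    then show "follower (language \<Sigma>) u \<in> follower (language \<Sigma>) ` R" using r(1) by simp
  qed
  then show ?thesis by (rule finite_subset) (simp add: R(1))
qed

lemma subshift_drop:
  assumes "subshift g \<Sigma>" "x \<in> \<Sigma>"
  shows "(\<lambda>i. x (i + k)) \<in> \<Sigma>"
proof (induction k)
  case (Suc k)
  have "left_shift (\<lambda>i. x (i + k)) \<in> \<Sigma>" using assms(1) Suc by (auto simp: subshift_def)
  then show ?case by (simp add: left_shift_def)
qed (use assms in simp)

lemma language_factor:
  assumes "subshift g \<Sigma>" "u @ v @ w \<in> language \<Sigma>"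
  shows "v \<in> language \<Sigma>"
proof -
  obtain x n where x: "x \<in> \<Sigma>" "u @ v @ w = map x [0..<n]"
    using assms(2) by (auto simp: language_def)
  have n: "n = length u + length v + length w"
    using arg_cong[OF x(2), of length] by simp
  have "v ! i = x (i + length u)" if "i < length v" for i
    using arg_cong[OF x(2), of "\<lambda>xs. xs ! (i + length u)"] that n by (simp add: nth_append)
  then have "v = map (\<lambda>i. x (i + length u)) [0..<length v]"
    by (intro nth_equalityI) simp_all
  then show ?thesis using subshift_drop[OF assms(1) x(1)] unfolding language_def by blast
qed

text \<open>A number is determined by its quotient and remainder modulo \<open>g ^ m\<close>, and
  \<open>A\<close> contains both.\<close>

lemma card_submultiplicative:
  fixes g :: nat
  assumes "g > 0" and A: "\<And>x m. x \<in> A \<Longrightarrow> x mod g ^ m \<in> A" "\<And>x m. x \<in> A \<Longrightarrow> x div g ^ m \<in> A"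
  shows "card (A \<inter> {0..<g ^ (m + n)}) \<le> card (A \<inter> {0..<g ^ m}) * card (A \<inter> {0..<g ^ n})"
proof -
  have "card (A \<inter> {0..<g ^ (m + n)}) \<le> card ((A \<inter> {0..<g ^ m}) \<times> (A \<inter> {0..<g ^ n}))"
  proof (rule card_inj_on_le)
    show "inj_on (\<lambda>x. (x mod g ^ m, x div g ^ m)) (A \<inter> {0..<g ^ (m + n)})"
      by (rule inj_onI) (metis Pair_inject mod_mult_div_eq)
    show "(\<lambda>x. (x mod g ^ m, x div g ^ m)) ` (A \<inter> {0..<g ^ (m + n)}) \<subseteq>
        (A \<inter> {0..<g ^ m}) \<times> (A \<inter> {0..<g ^ n})"
      using \<open>g > 0\<close> A by (auto simp: less_mult_imp_div_less power_add mult.commute)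
  qed simp
  then show ?thesis by (simp add: card_cartesian_product)
qed

theorem theorem6p6:
  fixes g a b :: nat and \<Sigma> :: "(nat \<Rightarrow> nat) set"
  assumes "g \<ge> 2"
    and "subshift g \<Sigma>"
    and "transitive_shift \<Sigma>"
    and "sofic \<Sigma>"
    and "a \<ge> 1"
  shows "((\<exists>w\<in>language \<Sigma>. length w \<ge> a - 1 \<and> [word_value g w = b] (mod a)) \<longrightarrow>
            same_mass_dim (shift_integers g \<Sigma> \<inter> arith_prog a b) (shift_integers g \<Sigma>))
       \<and> (same_mass_dim (shift_integers g \<Sigma> \<inter> arith_prog a b) (shift_integers g \<Sigma>)
          \<or> finite (shift_integers g \<Sigma> \<inter> arith_prog a b)
            \<and> card (shift_integers g \<Sigma> \<inter> arith_prog a b) \<le> g ^ a)"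
proof -
  let ?A = "shift_integers g \<Sigma>"
  let ?B = "?A \<inter> arith_prog a b"
  have L: "transitive_regular_language (language \<Sigma>)"
  proof
    show "v \<in> language \<Sigma>" if "u @ v @ w \<in> language \<Sigma>" for u v w
      using language_factor[OF assms(2) that] .
    show "\<exists>w. u @ w @ v \<in> language \<Sigma>" if "u \<in> language \<Sigma>" "v \<in> language \<Sigma>" for u v
      using assms(3) that unfolding transitive_shift_def by blast
    show "finite (range (follower (language \<Sigma>)))"
      using assms(4) by (rule sofic_finite_followers)
  qed
  interpret transitive_regular_language "language \<Sigma>" by (fact L)
  have digits: "set w \<subseteq> {..<g}" if "w \<in> language \<Sigma>" for w
    using that assms(2) by (auto simp: language_def subshift_def)
  have g0: "g > 0" using assms(1) by simp
  have "[] \<in> language \<Sigma>"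
    using assms(2) by (force simp: language_def subshift_def intro: exI[of _ 0])
  then have "0 \<in> ?A" unfolding shift_integers_def by (metis image_eqI word_value_Nil)
  have "x mod g ^ m \<in> ?A \<and> x div g ^ m \<in> ?A" if "x \<in> ?A" for x m
  proof -
    obtain w where w: "w \<in> language \<Sigma>" "x = word_value g w"
      using \<open>x \<in> ?A\<close> by (auto simp: shift_integers_def)
    have "take m w \<in> language \<Sigma>" "drop m w \<in> language \<Sigma>"
      using w(1) prefix[of "take m w" "drop m w"] suffix[of "take m w" "drop m w"] by simp_all
    then show ?thesis
      using mod_div_word_value[OF g0 digits[OF w(1)], of m] w(2) by (auto simp: shift_integers_def)
  qed
  then have submult: "card (?A \<inter> {0..<g ^ (m + n)})
      \<le> card (?A \<inter> {0..<g ^ m}) * card (?A \<inter> {0..<g ^ n})" for m n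
    using card_submultiplicative[OF g0] by blast
  have dim: "same_mass_dim ?B ?A"
    if w: "w \<in> language \<Sigma>" "length w \<ge> a - 1" "[word_value g w = b] (mod a)" for w
  proof -
    obtain C K where "C > 0" "\<And>n. card (?A \<inter> {0..<g ^ n})
        \<le> C * (n + 1) * max 1 (card (?B \<inter> {0..<g ^ (n + K)}))"
      using card_values_le[OF assms(1) digits L assms(5) w] unfolding shift_integers_def by blast
    then show ?thesis
      using \<open>0 \<in> ?A\<close> submult by (intro same_mass_dim_of_card_le[OF assms(1) Int_lower1])
  qed
  have fin: "finite ?B \<and> card ?B \<le> g ^ a"
    if none: "\<not> (\<exists>w\<in>language \<Sigma>. length w \<ge> a - 1 \<and> [word_value g w = b] (mod a))"
  proof -
    \<comment> \<open>Every word with value in the progression has the right residue, so by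
      \<open>none\<close> it must be short, and its value is below \<open>g ^ a\<close>.\<close>
    have "?B \<subseteq> {..<g ^ a}"
    proof
      fix x assume x: "x \<in> ?B"
      then obtain w where w: "w \<in> language \<Sigma>" "x = word_value g w"
        unfolding shift_integers_def by blast
      have "[x = b] (mod a)" using x by (auto simp: arith_prog_def cong_def)
      then have "length w \<le> a" using none w by (metis diff_le_self nat_le_linear order_trans)
      then have "g ^ length w \<le> g ^ a" using g0 by (intro power_increasing) auto
      then show "x \<in> {..<g ^ a}" using word_value_less[OF digits[OF w(1)]] w(2) by simp
    qed
    then show ?thesis
      using card_mono[of "{..<g ^ a}" ?B] finite_subset[of ?B "{..<g ^ a}"] by simp
  qed
  from dim fin show ?thesis by blast
qed

end
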